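(* Let $\lambda\in(-\pi/2,\pi/2)$, put $A_n=|1+ne^{-i\lambda}|+|1-ne^{-i\lambda}|$ for $n\ge 1$ and $B=|1+e^{-i\lambda}|-|1-e^{-i\lambda}|$, and let $(d_n)_{n\ge1}$ be a sequence of complex numbers with $|d_n|\leq nB/A_n$ for all $n\geq 1$. Let $(a_n)_{n\ge2}$ and $(b_n)_{n\ge1}$ be sequences of complex numbers such that $H(z)=z-\sum_{n=2}^\infty |a_n|z^n$ and $G(z)=\sum_{n=1}^\infty |b_n|z^n$ are analytic functions in $\mathbb{D}$. If $$F_\epsilon(z)=z\left(\frac{H(z)+\epsilon G(z)}{z}\right)^{e^{i\lambda}\cos\lambda}$$ is analytic and $\lambda$-spirallike in $\mathbb{D}$ for each $\epsilon\in\mathbb{C}$ with $|\epsilon|=1$, then the harmonic mapping $$f(z)=h(z)+\overline{g(z)}=z+\sum_{n=2}^\infty d_na_nz^n+\overline{\sum_{n=1}^\infty d_nb_nz^n}$$ is hereditarily $\lambda$-spirallike.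
   Context: $\mathbb{D}=\{z\in\mathbb{C}:|z|<1\}$ and $\mathbb{D}_r=\{z:|z|<r\}$. $\mathcal{S}$ is the class of analytic univalent functions in $\mathbb{D}$ of the form $z+\sum_{n\ge2}c_nz^n$. For $\lambda\in(-\pi/2,\pi/2)$, a domain $\Omega$ containing the origin is $\lambda$-spirallike if for each $w_0\in\Omega$ the arc of $\lambda$-spiral from the origin to $w_0$, namely $\{w_0\exp(-e^{i\lambda}t):t\ge 0\}\cup\{0\}$, lies in $\Omega$. An analytic function $F$ is called $\lambda$-spirallike if $F\in\mathcal{S}$ and $F(\mathbb{D})$ is a $\lambda$-spirallike domain, equivalently $\mathrm{Re}\left(e^{-i\lambda}zF'(z)/F(z)\right)>0$ for $z\in\mathbb{D}\setminus\{0\}$. The power in $F_\epsilon$ is $\exp\left(e^{i\lambda}\cos\lambda\,\log(\cdot)\right)$ with an analytic branch on $\mathbb{D}$ of the logarithm of $(H(z)+\epsilon G(z))/z$ (extended analytically to $z=0$); that this quotient has no zeros and $F_\epsilon$ is well defined is part of the hypothesis. $\mathcal{H}$ is the class of harmonic functions $f=h+\overline{g}$ in $\mathbb{D}$, with $h,g$ analytic in $\mathbb{D}$, $h(z)=z+\sum_{n=2}^\infty \alpha_nz^n$, $g(z)=\sum_{n=1}^\infty \beta_nz^n$, that are sense-preserving, i.e. $|h'|^2-|g'|^2>0$ on $\mathbb{D}$. A function $f\in\mathcal{H}$ is hereditarily $\lambda$-spirallike if $f$ is univalent (injective) on $\mathbb{D}$ and $f(\mathbb{D}_r)$ is a $\lambda$-spirallike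 domain for each $0<r<1$; the conclusion includes $f\in\mathcal{H}$. *)

theory Defs
  imports "HOL-Complex_Analysis.Complex_Analysis"
begin

abbreviation unit_disc :: "complex set" where
  "unit_disc \<equiv> ball 0 1"

text \<open>\<open>F z = (\<Sum>n\<ge>k. c n * z ^ n)\<close> on the unit disc; convergence is part of the claim, and
  the values of \<open>c\<close> below \<open>k\<close> play no role.\<close>
definition disc_series :: "nat \<Rightarrow> (nat \<Rightarrow> complex) \<Rightarrow> (complex \<Rightarrow> complex) \<Rightarrow> bool" where
  "disc_series k c F \<longleftrightarrow> (\<forall>z\<in>unit_disc. (\<lambda>n. c (n + k) * z ^ (n + k)) sums F z)"

definition class_S :: "(complex \<Rightarrow> complex) set" where
  "class_S = {F. F analytic_on unit_disc \<and> inj_on F unit_disc \<and>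
                 (\<exists>c. disc_series 2 c (\<lambda>z. F z - z))}"

definition spirallike_domain :: "real \<Rightarrow> complex set \<Rightarrow> bool" where
  "spirallike_domain lam \<Omega> \<longleftrightarrow> open \<Omega> \<and> connected \<Omega> \<and> 0 \<in> \<Omega> \<and>
     (\<forall>w0\<in>\<Omega>. {w0 * exp (- (cis lam * complex_of_real t)) | t. t \<ge> 0} \<union> {0} \<subseteq> \<Omega>)"

definition spirallike :: "real \<Rightarrow> (complex \<Rightarrow> complex) \<Rightarrow> bool" where
  "spirallike lam F \<longleftrightarrow> F \<in> class_S \<and> spirallike_domain lam (F ` unit_disc)"

text \<open>\<open>F z = z * (Q z / z) powr p\<close>, where the power is formed with some analytic branch \<open>L\<close> on the
  whole disc of the logarithm of \<open>Q z / z\<close>. As \<open>L\<close> is analytic at \<open>0\<close>, so is the extension \<open>exp \<circ> L\<close>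
  of \<open>Q z / z\<close>, and neither has a zero.\<close>
definition is_power_transform ::
  "complex \<Rightarrow> (complex \<Rightarrow> complex) \<Rightarrow> (complex \<Rightarrow> complex) \<Rightarrow> bool" where
  "is_power_transform p Q F \<longleftrightarrow>
     (\<exists>L. L analytic_on unit_disc \<and> (\<forall>z\<in>unit_disc - {0}. exp (L z) = Q z / z) \<and>
          (\<forall>z\<in>unit_disc. F z = z * exp (p * L z)))"

definition class_H :: "(complex \<Rightarrow> complex) set" where
  "class_H = {f. \<exists>h g. h analytic_on unit_disc \<and> g analytic_on unit_disc \<and>
       (\<exists>\<alpha>. disc_series 2 \<alpha> (\<lambda>z. h z - z)) \<and> (\<exists>\<beta>. disc_series 1 \<beta> g) \<and>
       (\<forall>z\<in>unit_disc. f z = h z + cnj (g z)) \<and>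
       (\<forall>z\<in>unit_disc. (cmod (deriv h z))\<^sup>2 - (cmod (deriv g z))\<^sup>2 > 0)}"

definition hereditarily_spirallike :: "real \<Rightarrow> (complex \<Rightarrow> complex) \<Rightarrow> bool" where
  "hereditarily_spirallike lam f \<longleftrightarrow> f \<in> class_H \<and> inj_on f unit_disc \<and>
     (\<forall>r. 0 < r \<and> r < 1 \<longrightarrow> spirallike_domain lam (f ` ball 0 r))"

end

(*
  For F = z exp(p L) with p = exp(i lam) cos lam and exp(L) = Q/z, spirallikeness of F (via Schwarz's
  lemma applied to the self-maps z -> F^-1(exp(-exp(i lam) t) F(z))) says exactly Re(z Q'/Q) >= 0.
  The normalisation F'(0) = 1 makes exp(L(0)) = 1 + eps |b_1| real for every eps, so b_1 = 0.
  On the radius [0,1), Q = H - G is then positive with Q' >= 0, which gives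
  sum n (|a_n| + |b_n|) <= 1 and hence sum A_n |d_n| (|a_n| + |b_n|) <= B.  For a harmonic f with
  such coefficients |e^{-i lam} Df - f| < |e^{-i lam} Df + f|, where Df = z h' - conj(z g'), so
  Re(e^{-i lam} Df / f) > 0; this says that the pullback by f of the spiral flow strictly decreases
  |z|, so that the spirals stay inside f(D_r).
*)
theory Submission
  imports Defs
begin

section \<open>Power series and elementary estimates\<close>

lemma powser_deriv:
  fixes c :: "nat \<Rightarrow> complex"
  assumes "\<And>z. cmod z < 1 \<Longrightarrow> summable (\<lambda>n. c n * z ^ n)" "cmod z < 1"
  shows "((\<lambda>z. \<Sum>n. c n * z ^ n) has_field_derivative
           (\<Sum>n. of_nat n * c n * z ^ (n - 1))) (at z)"
    and "summable (\<lambda>n. of_nat n * c n * z ^ (n - 1))"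
proof -
  have s: "summable (\<lambda>n. diffs c n * z ^ n)"
    using assms by (intro termdiff_converges[where K = 1]) auto
  show "((\<lambda>z. \<Sum>n. c n * z ^ n) has_field_derivative
           (\<Sum>n. of_nat n * c n * z ^ (n - 1))) (at z)"
    using termdiffs_strong'[where K = 1 and c = c, OF assms] diffs_equiv[OF s]
    by (simp add: sums_iff)
  show "summable (\<lambda>n. of_nat n * c n * z ^ (n - 1))"
    using diffs_equiv[OF s] by (simp add: sums_iff)
qed

text \<open>For \<open>n \<ge> 2\<close> each of the \<open>n\<close> monomials in
  \<open>(z ^ n - w ^ n) / (z - w)\<close> has degree at least 1, which yields the factor
  \<open>r\<close> beyond the Lipschitz constant \<open>n\<close>. This factor later gives the
  strict inequality behind injectivity, where the coefficient sum may equal 1.\<close>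

lemma norm_power_diff_le_radius:
  fixes z w :: complex
  assumes "cmod z \<le> r" "cmod w \<le> r" "r \<le> 1" "n \<ge> 2"
  shows "cmod (z ^ n - w ^ n) \<le> real n * r * cmod (z - w)"
proof -
  obtain m where m: "n = Suc m" "m \<ge> 1" using \<open>n \<ge> 2\<close> by (cases n) auto
  have r: "0 \<le> r" using assms(1) norm_ge_zero order_trans by blast
  have "z ^ n - w ^ n = z * (z ^ m - w ^ m) + (z - w) * w ^ m"
    by (simp add: m algebra_simps)
  then have "cmod (z ^ n - w ^ n) \<le> cmod z * cmod (z ^ m - w ^ m) + cmod (z - w) * cmod w ^ m"
    by (metis norm_mult norm_power norm_triangle_ineq)
  also have "\<dots> \<le> r * (real m * cmod (z - w)) + cmod (z - w) * r"
  proof (intro add_mono mult_mono)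
    show "cmod (z ^ m - w ^ m) \<le> real m * cmod (z - w)"
      using assms by (intro norm_power_diff) auto
    have "cmod w ^ m \<le> cmod w ^ 1"
      using assms m by (intro power_decreasing) auto
    then show "cmod w ^ m \<le> r" using assms by simp
  qed (use assms r in auto)
  also have "\<dots> = real n * r * cmod (z - w)" by (simp add: m algebra_simps)
  finally show ?thesis .
qed

text \<open>The map in \<open>u\<close> is the real differential of a harmonic function
  \<open>h + cnj g\<close> with \<open>h' = p\<close> and \<open>g' = q\<close>. Its Jacobian
  determinant is \<open>D\<close>, and the map in \<open>w\<close> is the inverse given by Cramer's
  rule.\<close>

lemma real_linear_comp_inverse:
  fixes p q :: complex
  assumes "cmod q < cmod p"
  defines "D \<equiv> complex_of_real ((cmod p)\<^sup>2 - (cmod q)\<^sup>2)"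
  shows "(\<lambda>u. p * u + cnj (q * u)) \<circ> (\<lambda>w. (cnj p * w - cnj (q * w)) / D) = id"
proof -
  have "D \<noteq> 0"
    using assms power_strict_mono[OF assms(1), of 2] by (auto simp flip: of_real_diff of_real_power)
  have D: "D = p * cnj p - q * cnj q" "cnj D = D"
    by (simp_all add: D_def complex_norm_square[symmetric])
  have "p * ((cnj p * w - cnj (q * w)) / D) + cnj (q * ((cnj p * w - cnj (q * w)) / D)) = w" for w
  proof -
    have "p * ((cnj p * w - cnj (q * w)) / D) + cnj (q * ((cnj p * w - cnj (q * w)) / D))
        = (p * (cnj p * w - cnj (q * w)) + cnj (q * (cnj p * w - cnj (q * w)))) / D"
      by (simp add: D(2) add_divide_distrib)
    also have "\<dots> = (w * D) / D"
      unfolding D(1) by (simp add: algebra_simps)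
    finally show ?thesis using \<open>D \<noteq> 0\<close> by simp
  qed
  then show ?thesis by (auto simp: fun_eq_iff)
qed

section \<open>The spiral flow and its pullback under a sense-preserving map\<close>

lemma spiral_has_vector_derivative:
  "((\<lambda>t. w * exp (- (c * complex_of_real t))) has_vector_derivative
     - c * (w * exp (- (c * complex_of_real t)))) (at t within S)"
proof -
  have "((\<lambda>s. w * exp (- (c * s))) has_field_derivative - c * (w * exp (- (c * complex_of_real t))))
          (at (complex_of_real t))"
    by (auto intro!: derivative_eq_intros)
  from has_vector_derivative_real_field[OF this] show ?thesis
    by (simp add: o_def)
qed

lemma has_real_derivative_cmod_square:
  assumes "(k has_vector_derivative u) (at t within S)"
  shows "((\<lambda>t. (cmod (k t))\<^sup>2) has_real_derivative 2 * Re (cnj (k t) * u)) (at t within S)"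
proof -
  have "(k has_derivative (\<lambda>h. h *\<^sub>R u)) (at t within S)"
    using assms by (simp add: has_vector_derivative_def)
  from has_derivative_inner[OF this this]
  have "((\<lambda>t. (cmod (k t))\<^sup>2) has_derivative (\<lambda>h. k t \<bullet> (h *\<^sub>R u) + (h *\<^sub>R u) \<bullet> k t)) (at t within S)"
    by (simp only: dot_square_norm)
  moreover have "(\<lambda>h. k t \<bullet> (h *\<^sub>R u) + (h *\<^sub>R u) \<bullet> k t) = (*) (2 * Re (cnj (k t) * u))"
    by (rule ext) (simp add: inner_complex_def algebra_simps)
  ultimately show ?thesis
    by (simp only: has_field_derivative_def)
qed

text \<open>Let a spiral start at \<open>f z0\<close> with \<open>cmod z0 = \<rho>\<close>. Whenever
  its pullback lies on the circle of radius \<open>\<rho>\<close>, the hypothesis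
  \<open>spiral\<close> makes the squared modulus of the pullback strictly decrease. Hence the
  spiral never leaves the image of \<open>cball 0 \<rho>\<close>, which lies inside the image of
  \<open>ball 0 r\<close>.\<close>

lemma spirallike_image_of_ball:
  fixes f p q :: "complex \<Rightarrow> complex"
  assumes inj: "inj_on f unit_disc" and f0: "f 0 = 0"
    and der: "\<And>z. z \<in> unit_disc \<Longrightarrow> (f has_derivative (\<lambda>u. p z * u + cnj (q z * u))) (at z)"
    and sense: "\<And>z. z \<in> unit_disc \<Longrightarrow> cmod (q z) < cmod (p z)"
    and spiral: "\<And>z. z \<in> unit_disc - {0} \<Longrightarrow>
        0 < Re (cis (- lam) * (z * p z - cnj (z * q z)) * cnj (f z))"
    and r: "0 < r" "r < 1"
  shows "spirallike_domain lam (f ` ball 0 r)"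
proof -
  have sub: "ball 0 s \<subseteq> unit_disc" "cball 0 \<rho> \<subseteq> unit_disc" if "s < 1" "\<rho> < 1" for s \<rho>
    using that by auto
  have cont: "continuous_on unit_disc f"
    using der has_derivative_continuous by (blast intro: continuous_at_imp_continuous_on)
  have op: "open (f ` ball 0 s)" if "s < 1" for s
    using sub(1)[of s] that cont inj
    by (intro invariance_of_domain) (auto intro: continuous_on_subset inj_on_subset)
  define g where "g = the_inv_into unit_disc f"
  have gf: "g (f z) = z" if "z \<in> unit_disc" for z
    unfolding g_def by (rule the_inv_into_f_f[OF inj that])
  define g' where "g' z w = (cnj (p z) * w - cnj (q z * w)) / complex_of_real ((cmod (p z))\<^sup>2 - (cmod (q z))\<^sup>2)"
    for z w
  have gder: "(g has_derivative g' z) (at (f z))" if z: "z \<in> unit_disc" for z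
  proof (rule has_derivative_inverse_on[of unit_disc f "\<lambda>z u. p z * u + cnj (q z * u)" g z])
    show "(\<lambda>u. p z * u + cnj (q z * u)) \<circ> g' z = id"
      unfolding g'_def using real_linear_comp_inverse[OF sense[OF z]] .
  qed (use der gf z in auto)
  have main: "z0 \<in> ball 0 r \<Longrightarrow> 0 \<le> t1 \<Longrightarrow> f z0 * exp (- (cis lam * of_real t1)) \<in> f ` ball 0 r" for z0 t1
  proof (cases "z0 = 0")
    case True
    then show ?thesis using r by (auto simp: f0 image_iff intro!: bexI[of _ 0])
  next
    case False
    assume z0: "z0 \<in> ball 0 r" and t1: "0 \<le> t1"
    define \<rho> where "\<rho> = cmod z0"
    have \<rho>: "0 < \<rho>" "\<rho> < r" "\<rho> < 1" using z0 False r by (auto simp: \<rho>_def)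
    define w where "w t = f z0 * exp (- (cis lam * complex_of_real t))" for t
    have wcont: "continuous_on UNIV w"
      unfolding w_def by (intro continuous_intros)
    \<comment> \<open>This set of times is closed, contains 0 and, by \<open>step\<close>, contains
      a right neighbourhood of each of its points. Together these facts force it to contain every
      nonnegative time.\<close>
    define T where "T = {0..} \<inter> w -` (f ` cball 0 \<rho>)"
    have "compact (f ` cball 0 \<rho>)"
      using sub(2)[OF \<rho>(3) \<rho>(3)] cont by (intro compact_continuous_image) (auto intro: continuous_on_subset)
    then have "closed (w -` (f ` cball 0 \<rho>))"
      using wcont by (metis closed_vimage compact_imp_closed)
    then have Tcl: "closed T" unfolding T_def by auto
    have T0: "0 \<in> T" by (auto simp: T_def w_def \<rho>_def)
    have step: "\<exists>\<delta>>0. \<forall>h>0. h < \<delta> \<longrightarrow> t + h \<in> T" if t: "t \<in> T" for t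
    proof -
      obtain z where z: "cmod z \<le> \<rho>" "w t = f z" and t0: "t \<ge> 0" using t by (auto simp: T_def)
      have zU: "z \<in> unit_disc" using z \<rho> by simp
      \<comment> \<open>Injectivity and \<open>f 0 = 0\<close> keep the spiral away from 0, so the
        strict hypothesis \<open>spiral\<close> is applicable at \<open>z\<close>.\<close>
      have "w t \<noteq> 0"
        using inj z0 r False f0 unfolding w_def by (auto simp: inj_on_def)
      then have zn: "z \<noteq> 0" using z f0 by auto
      show ?thesis
      proof (cases "cmod z < \<rho>")
        case True
        then have "w t \<in> f ` ball 0 \<rho>" using z by auto
        moreover have "open (w -` (f ` ball 0 \<rho>))"
          using wcont op[OF \<rho>(3)] by (metis open_vimage)
        ultimately obtain e where e: "e > 0" "ball t e \<subseteq> w -` (f ` ball 0 \<rho>)"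
          by (meson openE vimageI)
        have "t + h \<in> T" if "0 < h" "h < e" for h
        proof -
          have "t + h \<in> w -` (f ` ball 0 \<rho>)" using that by (intro subsetD[OF e(2)]) (simp add: dist_real_def)
          then show ?thesis using that t0 by (auto simp: T_def)
        qed
        then show ?thesis using e(1) by blast
      next
        case False
        then have zr: "cmod z = \<rho>" using z by simp
        \<comment> \<open>The spiral pulled back to the disc. Its velocity \<open>u\<close> at time
          \<open>t\<close> comes from the inverse differential, and \<open>Re (cnj z * u)\<close> is
          half the derivative of its squared modulus.\<close>
        define k where "k s = g (w s)" for s
        have kt: "k t = z" using z(2) gf zU by (simp add: k_def)
        have wder: "(w has_vector_derivative - cis lam * w t) (at t)"
          unfolding w_def by (rule spiral_has_vector_derivative)
        have wder': "(w has_derivative (\<lambda>h. h *\<^sub>R (- cis lam * w t))) (at t)"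
          using wder unfolding has_vector_derivative_def .
        have "(k has_derivative (\<lambda>h. g' z (h *\<^sub>R (- cis lam * w t)))) (at t)"
          unfolding k_def by (rule has_derivative_compose[OF wder']) (simp only: z(2) gder[OF zU])
        moreover have "g' z (h *\<^sub>R v) = h *\<^sub>R g' z v" for h v
          by (simp add: g'_def scaleR_conv_of_real algebra_simps diff_divide_distrib)
        ultimately have kder: "(k has_vector_derivative g' z (- cis lam * f z)) (at t)"
          by (simp only: has_vector_derivative_def z(2))
        define u where "u = g' z (- cis lam * f z)"
        define D where "D = (cmod (p z))\<^sup>2 - (cmod (q z))\<^sup>2"
        have "D > 0" using sense[OF zU] by (simp add: D_def power_strict_mono)
        have "Re (cnj z * u) = Re (cnj z * (cnj (p z) * (- cis lam * f z) - cnj (q z * (- cis lam * f z)))) / D"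
          by (simp add: u_def g'_def D_def Re_divide_of_real flip: of_real_diff)
        also have "Re (cnj z * (cnj (p z) * (- cis lam * f z) - cnj (q z * (- cis lam * f z))))
           = - Re (cis (- lam) * (z * p z - cnj (z * q z)) * cnj (f z))"
          by (simp add: algebra_simps)
        finally have neg: "Re (cnj z * u) < 0"
          using \<open>D > 0\<close> spiral[of z] zU zn by (simp add: divide_neg_pos)
        obtain \<delta>1 where \<delta>1: "\<delta>1 > 0" "\<And>h. 0 < h \<Longrightarrow> h < \<delta>1 \<Longrightarrow> (cmod (k (t + h)))\<^sup>2 < (cmod (k t))\<^sup>2"
          using DERIV_neg_dec_right[OF has_real_derivative_cmod_square[OF kder]] neg
          unfolding kt u_def by force
        \<comment> \<open>Since \<open>g\<close> inverts \<open>f\<close> only on the image of the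
          disc, \<open>h\<close> is also taken so small that the spiral remains in the open image of
          \<open>ball 0 r\<close>.\<close>
        have "w t \<in> f ` ball 0 r" using z \<rho> by auto
        moreover have "open (w -` (f ` ball 0 r))"
          using wcont op[OF r(2)] by (metis open_vimage)
        ultimately obtain e where e: "e > 0" "ball t e \<subseteq> w -` (f ` ball 0 r)"
          by (meson openE vimageI)
        have "t + h \<in> T" if h: "0 < h" "h < min e \<delta>1" for h
        proof -
          have "t + h \<in> w -` (f ` ball 0 r)" using h by (intro subsetD[OF e(2)]) (simp add: dist_real_def)
          then obtain y where y: "cmod y < r" "w (t + h) = f y" by auto
          then have "k (t + h) = y" using gf r by (simp add: k_def)
          then have "(cmod y)\<^sup>2 < \<rho>\<^sup>2" using \<delta>1(2)[of h] h kt zr by simp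
          then have "cmod y \<le> \<rho>" using \<rho>(1) by (simp add: power2_less_imp_less less_imp_le)
          then show ?thesis using y t0 h by (auto simp: T_def)
        qed
        then show ?thesis using e(1) \<delta>1(1) by (metis min_less_iff_conj)
      qed
    qed
    have "t1 \<in> T"
    proof (rule ccontr)
      assume nt: "t1 \<notin> T"
      \<comment> \<open>The last time in \<open>T\<close> up to \<open>t1\<close>: it is attained
        because \<open>T\<close> is closed, and \<open>step\<close> contradicts its
        maximality.\<close>
      define s where "s = Sup (T \<inter> {..t1})"
      have "s \<in> T \<inter> {..t1}"
        unfolding s_def using Tcl T0 t1 by (intro closed_contains_Sup) auto
      then have s: "s \<in> T" "s < t1" using nt by (auto simp: order_le_less)
      obtain \<delta> where d: "\<delta> > 0" "\<And>h. 0 < h \<Longrightarrow> h < \<delta> \<Longrightarrow> s + h \<in> T" using step[OF s(1)] by blast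
      define h where "h = min (\<delta> / 2) (t1 - s)"
      have h: "0 < h" "h < \<delta>" "s + h \<le> t1" using d s by (auto simp: h_def)
      then have "s + h \<in> T \<inter> {..t1}" using d by auto
      then have "s + h \<le> s" unfolding s_def by (intro cSup_upper) auto
      then show False using h by simp
    qed
    then have "w t1 \<in> f ` cball 0 \<rho>" by (simp add: T_def)
    moreover have "cball 0 \<rho> \<subseteq> ball (0::complex) r" using \<rho> by auto
    ultimately show ?thesis unfolding w_def by blast
  qed
  have "connected (f ` ball 0 r)"
    using cont sub(1)[OF r(2) r(2)] by (intro connected_continuous_image) (auto intro: continuous_on_subset)
  moreover have z: "0 \<in> f ` ball 0 r" using f0 r by (auto simp: image_iff intro!: bexI[of _ 0])
  ultimately show ?thesis
    unfolding spirallike_domain_def using op[OF r(2)] main by auto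
qed

section \<open>A coefficient criterion for hereditarily spirallike harmonic mappings\<close>

definition spiral_weight :: "real \<Rightarrow> nat \<Rightarrow> real" where
  "spiral_weight lam n = cmod (1 + of_nat n * cis (- lam)) + cmod (1 - of_nat n * cis (- lam))"

text \<open>This is B of the theorem, as \<open>spiral_weight lam n\<close> is A_n. In
  \<open>spiral_condition\<close>, B is the gap between the moduli of the linear coefficients of
  \<open>W + fharm z\<close> and \<open>W - fharm z\<close>, and A_n is the total weight of the
  coefficients of index \<open>n\<close> in both.\<close>

definition spiral_bound :: "real \<Rightarrow> real" where
  "spiral_bound lam = cmod (1 + cis (- lam)) - cmod (1 - cis (- lam))"

text \<open>The two numbers under the moduli differ from each other's negative by nothing but their
  sum 2, whereas their difference is \<open>2 * n * cis (- lam)\<close>; the triangle inequality for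
  the difference is the useful one. With \<open>spiral_bound_le\<close> it gives n B <= A_n, so the
  weighted coefficient bound implies the unweighted one in \<open>index_sum_le\<close>.\<close>

lemma spiral_weight_ge: "2 * real n \<le> spiral_weight lam n"
proof -
  have "cmod (2 * (of_nat n * cis (- lam))) \<le> spiral_weight lam n"
    unfolding spiral_weight_def
    using norm_triangle_ineq4[of "1 + of_nat n * cis (- lam)" "1 - of_nat n * cis (- lam)"]
    by (simp only: diff_add_eq add_diff_cancel_left' diff_diff_eq2 mult_2 add.commute add_diff_cancel) (simp add: algebra_simps)
  then show ?thesis by (simp add: norm_mult)
qed

lemma spiral_bound_le: "spiral_bound lam \<le> 2"
  using norm_triangle_ineq[of 1 "cis (- lam)"] norm_ge_zero[of "1 - cis (- lam)"]
  unfolding spiral_bound_def norm_one norm_cis by linarith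

text \<open>The squares of the two moduli differ by \<open>4 * Re (w * cnj v)\<close>. This turns
  positivity of a real part into a comparison of moduli, which coefficient estimates can
  reach.\<close>

lemma cmod_diff_less_cmod_add_iff: "cmod (w - v) < cmod (w + v) \<longleftrightarrow> 0 < Re (w * cnj v)"
proof -
  have "cmod (w - v) < cmod (w + v) \<longleftrightarrow> (cmod (w - v))\<^sup>2 < (cmod (w + v))\<^sup>2"
    by (metis norm_ge_zero power2_less_imp_less power_strict_mono zero_less_numeral)
  also have "\<dots> \<longleftrightarrow> 0 < Re (w * cnj v)"
    by (simp only: cmod_power2) (simp add: algebra_simps power2_eq_square, linarith)
  finally show ?thesis .
qed

lemma spiral_bound_pos:
  assumes "- pi / 2 < lam" "lam < pi / 2"
  shows "0 < spiral_bound lam"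
  using cmod_diff_less_cmod_add_iff[of 1 "cis (- lam)"] cos_gt_zero_pi[of lam] assms
  by (simp add: spiral_bound_def)

lemma disc_series_iff:
  assumes "\<And>n. n < k \<Longrightarrow> c n = 0"
  shows "disc_series k c F \<longleftrightarrow> (\<forall>z\<in>unit_disc. (\<lambda>n. c n * z ^ n) sums F z)"
  unfolding disc_series_def
  by (intro ball_cong refl sums_zero_iff_shift) (simp add: assms)

text \<open>A single majorant for the sum of both terms retains the joint bound on the analytic and
  co-analytic coefficients, which separate majorants would lose.\<close>

lemma suminf_pair_le:
  fixes u v :: "nat \<Rightarrow> complex"
  assumes "\<And>n. cmod (u n) + cmod (v n) \<le> X n" "summable X"
  shows "summable u" "summable v" "cmod (suminf u) + cmod (suminf v) \<le> suminf X"
proof -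
  have le: "cmod (u n) \<le> X n" "cmod (v n) \<le> X n" for n
    using assms(1)[of n] norm_ge_zero[of "u n"] norm_ge_zero[of "v n"] by linarith+
  have s: "summable (\<lambda>n. cmod (u n))" "summable (\<lambda>n. cmod (v n))"
    using le by (auto intro!: summable_comparison_test'[OF assms(2), of 0])
  then show "summable u" "summable v" by (auto intro: summable_norm_cancel)
  have "cmod (suminf u) + cmod (suminf v) \<le> (\<Sum>n. cmod (u n)) + (\<Sum>n. cmod (v n))"
    by (intro add_mono summable_norm s)
  also have "\<dots> = (\<Sum>n. cmod (u n) + cmod (v n))" by (rule suminf_add[OF s])
  also have "\<dots> \<le> suminf X" by (intro suminf_le assms summable_add s)
  finally show "cmod (suminf u) + cmod (suminf v) \<le> suminf X" .
qed

lemma spiral_weight_nonneg: "0 \<le> spiral_weight lam n"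
  by (simp add: spiral_weight_def)

text \<open>Here \<open>c\<close> and \<open>e\<close> stand for the products of \<open>d\<close>
  with the coefficients \<open>a\<close> and \<open>b\<close>. Both vanish below index 2, also in
  the co-analytic part, since the application has \<open>b 1 = 0\<close>.\<close>

context
  fixes lam :: real and c e :: "nat \<Rightarrow> complex"
  assumes lam: "- pi / 2 < lam" "lam < pi / 2"
    and zero: "\<And>n. n < 2 \<Longrightarrow> c n = 0 \<and> e n = 0"
    and summ: "summable (\<lambda>n. spiral_weight lam n * (cmod (c n) + cmod (e n)))"
    and le: "(\<Sum>n. spiral_weight lam n * (cmod (c n) + cmod (e n))) \<le> spiral_bound lam"
begin

lemma index_bound:
  "spiral_bound lam * (real n * (cmod (c n) + cmod (e n))) \<le> spiral_weight lam n * (cmod (c n) + cmod (e n))"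
proof -
  have "spiral_bound lam * real n \<le> 2 * real n"
    using spiral_bound_le by (intro mult_right_mono) auto
  also have "\<dots> \<le> spiral_weight lam n" by (rule spiral_weight_ge)
  finally show ?thesis by (simp add: mult_right_mono flip: mult.assoc)
qed

lemma index_summable: "summable (\<lambda>n. real n * (cmod (c n) + cmod (e n)))"
proof -
  have "summable (\<lambda>n. spiral_bound lam * (real n * (cmod (c n) + cmod (e n))))"
    by (rule summable_comparison_test'[OF summ, of 0])
       (use index_bound spiral_bound_pos[OF lam] in \<open>auto simp: abs_mult\<close>)
  then show ?thesis using spiral_bound_pos[OF lam] by (simp add: summable_cmult_iff)
qed

lemma index_sum_le: "(\<Sum>n. real n * (cmod (c n) + cmod (e n))) \<le> 1"
proof -
  have "spiral_bound lam * (\<Sum>n. real n * (cmod (c n) + cmod (e n)))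
      = (\<Sum>n. spiral_bound lam * (real n * (cmod (c n) + cmod (e n))))"
    by (rule suminf_mult[symmetric, OF index_summable])
  also have "\<dots> \<le> spiral_bound lam * 1"
    using suminf_le[OF index_bound summable_mult[OF index_summable] summ] le by simp
  finally show ?thesis using spiral_bound_pos[OF lam] by simp
qed

lemma powser_summable:
  assumes "cmod z < 1"
  shows "summable (\<lambda>n. c n * z ^ n)" "summable (\<lambda>n. e n * z ^ n)"
proof -
  have *: "x * cmod z ^ n \<le> real n * (cmod (c n) + cmod (e n))"
    if "x = cmod (c n) \<or> x = cmod (e n)" for n x
  proof (cases "n < 2")
    case True
    then show ?thesis using that zero by auto
  next
    case False
    have "x * cmod z ^ n \<le> x * 1"
      using assms that by (intro mult_left_mono power_le_one) auto
    also have "\<dots> \<le> 1 * (cmod (c n) + cmod (e n))" using that by auto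
    also have "\<dots> \<le> real n * (cmod (c n) + cmod (e n))"
      using False by (intro mult_right_mono) auto
    finally show ?thesis .
  qed
  show "summable (\<lambda>n. c n * z ^ n)" "summable (\<lambda>n. e n * z ^ n)"
    by (rule summable_comparison_test'[OF index_summable, of 0];
        use * in \<open>auto simp: norm_mult norm_power\<close>)+
qed

definition hpart :: "complex \<Rightarrow> complex" where "hpart z = z + (\<Sum>n. c n * z ^ n)"
definition gpart :: "complex \<Rightarrow> complex" where "gpart z = (\<Sum>n. e n * z ^ n)"
definition fharm :: "complex \<Rightarrow> complex" where "fharm z = hpart z + cnj (gpart z)"
definition hder :: "complex \<Rightarrow> complex" where "hder z = 1 + (\<Sum>n. of_nat n * c n * z ^ (n - 1))"
definition gder :: "complex \<Rightarrow> complex" where "gder z = (\<Sum>n. of_nat n * e n * z ^ (n - 1))"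

lemma has_field_derivative_parts:
  assumes "cmod z < 1"
  shows "(hpart has_field_derivative hder z) (at z)" "(gpart has_field_derivative gder z) (at z)"
  unfolding hpart_def[abs_def] gpart_def[abs_def] hder_def gder_def
  using powser_deriv(1)[of c z, OF powser_summable(1) assms]
    powser_deriv(1)[of e z, OF powser_summable(2) assms]
  by (auto intro: DERIV_add DERIV_ident)

text \<open>All indices are at least 2, so \<open>cmod z ^ (n - 1)\<close> is at most
  \<open>cmod z\<close>. Thus \<open>cmod (hder z - 1) + cmod (gder z)\<close> is at most
  \<open>cmod z\<close>, which is less than 1.\<close>

lemma sense_preserving:
  assumes "cmod z < 1"
  shows "cmod (gder z) < cmod (hder z)"
proof -
  have *: "cmod (of_nat n * c n * z ^ (n - 1)) + cmod (of_nat n * e n * z ^ (n - 1))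
      \<le> cmod z * (real n * (cmod (c n) + cmod (e n)))" for n
  proof (cases "n < 2")
    case True
    then show ?thesis using zero by simp
  next
    case False
    then have "cmod z ^ (n - 1) \<le> cmod z ^ 1"
      using assms by (intro power_decreasing) auto
    then have "cmod z ^ (n - 1) * (real n * (cmod (c n) + cmod (e n))) \<le> cmod z * (real n * (cmod (c n) + cmod (e n)))"
      by (intro mult_right_mono) auto
    then show ?thesis by (simp add: norm_mult norm_power algebra_simps)
  qed
  have "cmod (\<Sum>n. of_nat n * c n * z ^ (n - 1)) + cmod (gder z)
      \<le> (\<Sum>n. cmod z * (real n * (cmod (c n) + cmod (e n))))"
    unfolding gder_def by (intro suminf_pair_le(3) * summable_mult index_summable)
  also have "\<dots> \<le> cmod z * 1"
    unfolding suminf_mult[OF index_summable] by (intro mult_left_mono index_sum_le) auto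
  finally have "cmod (\<Sum>n. of_nat n * c n * z ^ (n - 1)) + cmod (gder z) < 1"
    using assms by simp
  then show ?thesis
    unfolding hder_def using norm_diff_ineq[of 1 "\<Sum>n. of_nat n * c n * z ^ (n - 1)"] by simp
qed

text \<open>If two values agree, \<open>z - w\<close> is cancelled by the differences of the
  higher-order terms, whose total modulus is at most \<open>r * cmod (z - w)\<close> with
  \<open>r < 1\<close>.\<close>

lemma inj_fharm: "inj_on fharm unit_disc"
proof (rule inj_onI, rule ccontr)
  fix z w :: complex
  assume zw: "z \<in> unit_disc" "w \<in> unit_disc" and eq: "fharm z = fharm w" and ne: "z \<noteq> w"
  define r where "r = max (cmod z) (cmod w)"
  have r: "cmod z \<le> r" "cmod w \<le> r" "r < 1" "0 \<le> r" using zw by (auto simp: r_def le_max_iff_disj)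
  define K where "K = r * cmod (z - w)"
  have *: "cmod (c n * z ^ n - c n * w ^ n) + cmod (e n * z ^ n - e n * w ^ n)
      \<le> K * (real n * (cmod (c n) + cmod (e n)))" for n
  proof (cases "n < 2")
    case True
    then show ?thesis using zero by simp
  next
    case False
    have "(cmod (c n) + cmod (e n)) * cmod (z ^ n - w ^ n)
       \<le> (cmod (c n) + cmod (e n)) * (real n * r * cmod (z - w))"
      using r False by (intro mult_left_mono norm_power_diff_le_radius) auto
    then show ?thesis
      unfolding K_def right_diff_distrib[symmetric] norm_mult distrib_right[symmetric]
      by (simp add: mult_ac)
  qed
  have s: "summable (\<lambda>n. c n * z ^ n)" "summable (\<lambda>n. c n * w ^ n)"
     "summable (\<lambda>n. e n * z ^ n)" "summable (\<lambda>n. e n * w ^ n)"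
    using powser_summable zw by auto
  have "cmod ((\<Sum>n. c n * z ^ n) - (\<Sum>n. c n * w ^ n)) + cmod (gpart z - gpart w)
      \<le> (\<Sum>n. K * (real n * (cmod (c n) + cmod (e n))))"
    unfolding gpart_def suminf_diff[OF s(1,2)] suminf_diff[OF s(3,4)]
    by (intro suminf_pair_le(3) * summable_mult index_summable)
  also have "\<dots> \<le> K * 1"
    unfolding suminf_mult[OF index_summable] using r
    by (intro mult_left_mono index_sum_le) (auto simp: K_def)
  also have "\<dots> < cmod (z - w)" using r ne by (simp add: K_def)
  finally have "cmod ((\<Sum>n. c n * z ^ n) - (\<Sum>n. c n * w ^ n)) + cmod (gpart z - gpart w) < cmod (z - w)" .
  moreover have "z - w = - ((\<Sum>n. c n * z ^ n) - (\<Sum>n. c n * w ^ n)) - cnj (gpart z - gpart w)"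
    using eq by (simp add: fharm_def hpart_def algebra_simps)
  then have "cmod (z - w) \<le> cmod ((\<Sum>n. c n * z ^ n) - (\<Sum>n. c n * w ^ n)) + cmod (gpart z - gpart w)"
    by (metis complex_mod_cnj norm_minus_cancel norm_triangle_ineq4)
  ultimately show False by simp
qed

lemma times_powser_deriv:
  assumes "cmod z < 1"
  shows "(\<lambda>n. of_nat n * (c n * z ^ n)) sums (z * hder z - z)"
    "(\<lambda>n. of_nat n * (e n * z ^ n)) sums (z * gder z)"
proof -
  \<comment> \<open>For \<open>n = 0\<close> the truncated exponent \<open>n - 1\<close> is 0, but
    the factor \<open>of_nat n\<close> makes both sides vanish.\<close>
  have *: "z * (of_nat n * x n * z ^ (n - 1)) = of_nat n * (x n * z ^ n)" for n x
    by (cases n) simp_all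
  show "(\<lambda>n. of_nat n * (c n * z ^ n)) sums (z * hder z - z)"
    "(\<lambda>n. of_nat n * (e n * z ^ n)) sums (z * gder z)"
    using sums_mult[OF summable_sums[OF powser_deriv(2)[of c z, OF powser_summable(1) assms]], of z]
      sums_mult[OF summable_sums[OF powser_deriv(2)[of e z, OF powser_summable(2) assms]], of z]
    unfolding hder_def gder_def * by (simp_all only: ring_distribs mult_1_right add_diff_cancel_left')
qed

text \<open>The claim is equivalent to \<open>cmod (W - fharm z) < cmod (W + fharm z)\<close>. The
  linear parts of these two expressions are \<open>(E - 1) * z\<close> and
  \<open>(1 + E) * z\<close>; their moduli differ by B times \<open>cmod z\<close>, while the
  remaining terms contribute at most B times the square of \<open>cmod z\<close>.\<close>

lemma spiral_condition:
  assumes z: "z \<in> unit_disc - {0}"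
  shows "0 < Re (cis (- lam) * (z * hder z - cnj (z * gder z)) * cnj (fharm z))"
proof -
  define E where "E = cis (- lam)"
  define W where "W = E * (z * hder z - cnj (z * gder z))"
  define C where "C = spiral_weight lam"
  have z1: "cmod z < 1" "0 < cmod z" using z by auto
  have S: "(\<lambda>n. c n * z ^ n) sums (hpart z - z)" "(\<lambda>n. e n * z ^ n) sums gpart z"
    using powser_summable[OF z1(1)] by (auto simp: hpart_def gpart_def summable_sums)
  note T = times_powser_deriv[OF z1(1)]
  \<comment> \<open>\<open>u1 + u2\<close> and \<open>v1 + v2\<close> are the higher-order terms of
    \<open>W + fharm z\<close> and \<open>W - fharm z\<close>. The multipliers in \<open>u1\<close>
    and \<open>v1\<close> have moduli adding up to \<open>C n\<close>, and so have those in
    \<open>u2\<close> and \<open>v2\<close>.\<close>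
  define u1 where "u1 n = (1 + of_nat n * E) * (c n * z ^ n)" for n
  define u2 where "u2 n = (1 - of_nat n * E) * cnj (e n * z ^ n)" for n
  define v1 where "v1 n = (of_nat n * E - 1) * (c n * z ^ n)" for n
  define v2 where "v2 n = - (1 + of_nat n * E) * cnj (e n * z ^ n)" for n
  have Wsum: "(\<lambda>n. E * (of_nat n * (c n * z ^ n)) - E * cnj (of_nat n * (e n * z ^ n))) sums (W - E * z)"
    using sums_diff[OF sums_mult[OF T(1), of E] sums_mult[OF sums_cnj[THEN iffD2, OF T(2)], of E]]
    by (rule back_subst) (simp add: W_def right_diff_distrib)
  have Fsum: "(\<lambda>n. c n * z ^ n + cnj (e n * z ^ n)) sums (fharm z - z)"
    using sums_add[OF S(1) sums_cnj[THEN iffD2, OF S(2)]]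
    by (rule back_subst) (simp add: fharm_def)
  have "(\<lambda>n. u1 n + u2 n) sums (W - E * z + (fharm z - z))"
    using sums_add[OF Wsum Fsum]
    by (rule back_subst[of "\<lambda>u. u sums _"]) (simp add: u1_def u2_def algebra_simps)
  then have U: "(\<lambda>n. u1 n + u2 n) sums (W + fharm z - (1 + E) * z)"
    by (rule back_subst) (simp add: algebra_simps)
  have "(\<lambda>n. v1 n + v2 n) sums (W - E * z - (fharm z - z))"
    using sums_diff[OF Wsum Fsum]
    by (rule back_subst[of "\<lambda>u. u sums _"]) (simp add: v1_def v2_def algebra_simps)
  then have V: "(\<lambda>n. v1 n + v2 n) sums (W - fharm z + (1 - E) * z)"
    by (rule back_subst) (simp add: algebra_simps)
  have *: "cmod (u1 n + u2 n) + cmod (v1 n + v2 n) \<le> (cmod z)\<^sup>2 * (C n * (cmod (c n) + cmod (e n)))" for n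
  proof (cases "n < 2")
    case True
    then show ?thesis using zero by (simp add: u1_def u2_def v1_def v2_def)
  next
    case False
    then have zn: "cmod z ^ n \<le> (cmod z)\<^sup>2" using z1 by (intro power_decreasing) auto
    have sw: "cmod (of_nat n * E - 1) = cmod (1 - of_nat n * E)" by (rule norm_minus_commute)
    have "cmod (u1 n + u2 n) + cmod (v1 n + v2 n) \<le> cmod (u1 n) + cmod (u2 n) + (cmod (v1 n) + cmod (v2 n))"
      by (intro add_mono norm_triangle_ineq)
    also have "\<dots> = cmod z ^ n * (C n * (cmod (c n) + cmod (e n)))"
      unfolding u1_def u2_def v1_def v2_def C_def spiral_weight_def E_def[symmetric] norm_mult
        norm_minus_cancel sw complex_mod_cnj norm_power
      by (simp add: algebra_simps)
    also have "\<dots> \<le> (cmod z)\<^sup>2 * (C n * (cmod (c n) + cmod (e n)))"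
      using zn spiral_weight_nonneg by (intro mult_right_mono) (auto simp: C_def)
    finally show ?thesis .
  qed
  have "cmod (W + fharm z - (1 + E) * z) + cmod (W - fharm z + (1 - E) * z)
      \<le> (\<Sum>n. (cmod z)\<^sup>2 * (C n * (cmod (c n) + cmod (e n))))"
    unfolding sums_unique[OF U] sums_unique[OF V] C_def
    by (intro suminf_pair_le(3) summable_mult summ) (use * in \<open>simp add: C_def\<close>)
  also have "\<dots> \<le> (cmod z)\<^sup>2 * spiral_bound lam"
    unfolding C_def suminf_mult[OF summ] by (intro mult_left_mono le) auto
  \<comment> \<open>Strictness comes from \<open>0 < cmod z < 1\<close> and B > 0, so equality in
    the coefficient bound is allowed.\<close>
  also have "\<dots> < cmod z * spiral_bound lam"
    using z1 spiral_bound_pos[OF lam] by (simp add: power2_eq_square)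
  also have "\<dots> = cmod ((1 + E) * z) - cmod ((1 - E) * z)"
    unfolding spiral_bound_def E_def norm_mult by (simp only: mult.commute right_diff_distrib)
  finally have "cmod ((1 - E) * z) + cmod (W - fharm z + (1 - E) * z)
      < cmod ((1 + E) * z) - cmod (W + fharm z - (1 + E) * z)" by simp
  moreover have "cmod (W - fharm z) \<le> cmod (W - fharm z + (1 - E) * z) + cmod ((1 - E) * z)"
    using norm_triangle_ineq4[of "W - fharm z + (1 - E) * z" "(1 - E) * z"] by simp
  moreover have "cmod ((1 + E) * z) \<le> cmod (W + fharm z) + cmod (W + fharm z - (1 + E) * z)"
    using norm_triangle_ineq4[of "W + fharm z" "W + fharm z - (1 + E) * z"] by simp
  ultimately have "cmod (W - fharm z) < cmod (W + fharm z)" by linarith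
  then show ?thesis
    unfolding cmod_diff_less_cmod_add_iff by (simp add: W_def E_def)
qed

lemma fharm_in_class_H: "fharm \<in> class_H"
  unfolding class_H_def
proof (intro CollectI exI conjI ballI)
  have hol: "hpart holomorphic_on unit_disc" "gpart holomorphic_on unit_disc"
    using has_field_derivative_parts by (fastforce simp: holomorphic_on_open)+
  then show "hpart analytic_on unit_disc" "gpart analytic_on unit_disc"
    by (auto simp: analytic_on_open)
  show "disc_series 2 c (\<lambda>z. hpart z - z)" "disc_series 1 e gpart"
    using powser_summable zero
    by (auto simp: disc_series_iff hpart_def gpart_def summable_sums)
  show "fharm z = hpart z + cnj (gpart z)" for z by (rule fharm_def)
  show "0 < (cmod (deriv hpart z))\<^sup>2 - (cmod (deriv gpart z))\<^sup>2" if "z \<in> unit_disc" for z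
    using has_field_derivative_parts[of z] sense_preserving[of z] that
    by (simp add: DERIV_imp_deriv power_strict_mono)
qed

lemma hereditarily_spirallike_coefficients:
  "hereditarily_spirallike lam (\<lambda>z. z + (\<Sum>n. c n * z ^ n) + cnj (\<Sum>n. e n * z ^ n))"
proof -
  have der: "(fharm has_derivative (\<lambda>u. hder z * u + cnj (gder z * u))) (at z)"
    if "z \<in> unit_disc" for z
    unfolding fharm_def[abs_def]
    by (intro has_derivative_add has_derivative_cnj)
       (use has_field_derivative_parts[of z] that in \<open>simp_all add: has_field_derivative_def\<close>)
  have f0: "fharm 0 = 0"
    using zero[of 0] by (simp add: fharm_def hpart_def gpart_def)
  have "hereditarily_spirallike lam fharm"
    unfolding hereditarily_spirallike_def
    using fharm_in_class_H inj_fharm sense_preserving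
    by (auto intro!: spirallike_image_of_ball[OF inj_fharm f0 der _ spiral_condition])
  moreover have "fharm = (\<lambda>z. z + (\<Sum>n. c n * z ^ n) + cnj (\<Sum>n. e n * z ^ n))"
    by (simp add: fun_eq_iff fharm_def hpart_def gpart_def)
  ultimately show ?thesis by simp
qed

end

section \<open>From analytic spirallike functions to bounds on coefficients\<close>

lemma disc_series_deriv:
  assumes F: "\<And>z. z \<in> unit_disc \<Longrightarrow> (\<lambda>n. c n * z ^ n) sums F z" and z: "z \<in> unit_disc"
  shows "(F has_field_derivative (\<Sum>n. of_nat n * c n * z ^ (n - 1))) (at z)"
    and "summable (\<lambda>n. of_nat n * c n * z ^ (n - 1))"
proof -
  have s: "summable (\<lambda>n. c n * z ^ n)" if "cmod z < 1" for z
    using F[of z] that by (simp add: sums_iff)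
  have "((\<lambda>z. \<Sum>n. c n * z ^ n) has_field_derivative (\<Sum>n. of_nat n * c n * z ^ (n - 1))) (at z)"
    using s z by (intro powser_deriv) auto
  then show "(F has_field_derivative (\<Sum>n. of_nat n * c n * z ^ (n - 1))) (at z)"
    by (rule has_field_derivative_transform_within_open[OF _ open_ball z])
       (use F in \<open>auto simp: sums_iff\<close>)
  show "summable (\<lambda>n. of_nat n * c n * z ^ (n - 1))"
    using s z by (intro powser_deriv) auto
qed

lemma disc_series_deriv_0:
  assumes "\<And>z. z \<in> unit_disc \<Longrightarrow> (\<lambda>n. c n * z ^ n) sums F z"
  shows "(F has_field_derivative c 1) (at 0)" "F 0 = c 0"
proof -
  \<comment> \<open>Both \<open>n = 0\<close> and \<open>n = 1\<close> have
    \<open>0 ^ (n - 1) = 1\<close>; the factor \<open>of_nat n\<close> removes the former.\<close>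
  have "(\<Sum>n. of_nat n * c n * 0 ^ (n - 1)) = (\<Sum>n\<in>{1}. of_nat n * c n * 0 ^ (n - 1))"
    by (intro suminf_finite) (auto simp: power_0_left)
  then show "(F has_field_derivative c 1) (at 0)"
    using disc_series_deriv(1)[OF assms, of 0] by simp
  have "F 0 = (\<Sum>n. c n * 0 ^ n)" using assms[of 0] by (simp add: sums_iff)
  also have "\<dots> = c 0" by (rule powser_zero)
  finally show "F 0 = c 0" .
qed

text \<open>The values of \<open>c\<close> below \<open>k\<close> are arbitrary in
  \<open>disc_series\<close>; replacing them by 0 allows the index shift to be undone.\<close>

lemma disc_series_padded:
  "disc_series k c F \<longleftrightarrow> (\<forall>z\<in>unit_disc. (\<lambda>n. (if n < k then 0 else c n) * z ^ n) sums F z)"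
proof -
  have "disc_series k c F \<longleftrightarrow> disc_series k (\<lambda>n. if n < k then 0 else c n) F"
    by (simp add: disc_series_def)
  then show ?thesis
    unfolding disc_series_def
    using sums_zero_iff_shift[of k "\<lambda>n. (if n < k then 0 else c n) * z ^ n" for z] by simp
qed

lemma class_S_normalized:
  assumes "F \<in> class_S"
  shows "F holomorphic_on unit_disc" "inj_on F unit_disc" "F 0 = 0" "(F has_field_derivative 1) (at 0)"
proof -
  obtain c where F: "F analytic_on unit_disc" "inj_on F unit_disc" and c: "disc_series 2 c (\<lambda>z. F z - z)"
    using assms by (auto simp: class_S_def)
  then show "F holomorphic_on unit_disc" "inj_on F unit_disc"
    by (auto simp: analytic_imp_holomorphic)
  define c' where "c' n = (if n < 2 then 0 else c n)" for n
  have "\<And>z. z \<in> unit_disc \<Longrightarrow> (\<lambda>n. c' n * z ^ n) sums (F z - z)"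
    using c by (simp add: disc_series_padded c'_def)
  from disc_series_deriv_0[OF this]
  have *: "((\<lambda>z. F z - z) has_field_derivative 0) (at 0)" "F 0 = 0" by (simp_all add: c'_def)
  show "F 0 = 0" by fact
  show "(F has_field_derivative 1) (at 0)"
    using DERIV_add[OF *(1) DERIV_ident] by simp
qed

text \<open>For fixed \<open>t \<ge> 0\<close>, following the spiral in the image for time
  \<open>t\<close> and pulling back by the inverse \<open>g\<close> is a holomorphic self-map of the
  disc fixing 0. By Schwarz it does not increase the modulus, so the squared modulus has nonpositive
  derivative at \<open>t = 0\<close>. Multiplying by \<open>cnj (F z)\<close> instead of dividing by
  \<open>F z\<close> includes \<open>z = 0\<close>.\<close>

lemma spirallike_nonneg:
  assumes S: "spirallike lam F" and z: "z \<in> unit_disc"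
  shows "0 \<le> Re (cis (- lam) * (z * deriv F z) * cnj (F z))"
proof -
  have FS: "F \<in> class_S" and dom: "spirallike_domain lam (F ` unit_disc)"
    using S by (auto simp: spirallike_def)
  note F = class_S_normalized[OF FS]
  obtain g where g: "g holomorphic_on (F ` unit_disc)"
      "\<And>z. z \<in> unit_disc \<Longrightarrow> deriv F z * deriv g (F z) = 1" "\<And>z. z \<in> unit_disc \<Longrightarrow> g (F z) = z"
    using holomorphic_has_inverse[OF F(1) open_ball F(2)] by metis
  have op: "open (F ` unit_disc)" using dom by (simp add: spirallike_domain_def)
  define w where "w t y = F y * exp (- (cis lam * complex_of_real t))" for t y
  have win: "w t y \<in> F ` unit_disc" if "t \<ge> 0" "y \<in> unit_disc" for t y
    using dom that unfolding spirallike_domain_def w_def by blast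
  have schwarz: "cmod (g (w t z)) \<le> cmod z" if "t \<ge> 0" for t
  proof (rule Schwarz_Lemma(1))
    have "w t holomorphic_on unit_disc"
      unfolding w_def using F(1) by (intro holomorphic_intros)
    then show "(\<lambda>y. g (w t y)) holomorphic_on unit_disc"
      using holomorphic_on_compose_gen[of "w t" unit_disc g "F ` unit_disc"] g(1)
        image_subsetI[of unit_disc "w t", OF win[OF that]]
      by (simp add: o_def)
    show "g (w t 0) = 0" using g(3)[of 0] F(3) by (simp add: w_def)
    show "cmod (g (w t y)) < 1" if "cmod y < 1" for y
      using win[OF \<open>t \<ge> 0\<close>, of y] that g(3) by auto
    show "cmod z < 1" using z by simp
  qed
  have wder: "((\<lambda>t. w t z) has_vector_derivative - cis lam * F z) (at 0)"
    using spiral_has_vector_derivative[of "F z" "cis lam" 0 UNIV] by (simp add: w_def)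
  have w0: "w 0 z = F z" by (simp add: w_def)
  have "(g has_field_derivative deriv g (F z)) (at (w 0 z))"
    using g(1) op z by (simp add: w0 holomorphic_derivI)
  from field_vector_diff_chain_at[OF wder this]
  have kder: "((\<lambda>t. g (w t z)) has_vector_derivative - cis lam * F z * deriv g (F z)) (at 0)"
    by (simp add: o_def)
  define u where "u = - cis lam * F z * deriv g (F z)"
  have "Re (cnj z * u) \<le> 0"
  proof (rule ccontr)
    assume "\<not> Re (cnj z * u) \<le> 0"
    then have "0 < 2 * Re (cnj (g (w 0 z)) * u)" using g(3)[OF z] by (simp add: w0)
    from DERIV_pos_inc_right[OF has_real_derivative_cmod_square[OF kder, folded u_def] this]
    obtain d where "d > 0" "\<And>h. 0 < h \<Longrightarrow> h < d \<Longrightarrow> (cmod (g (w 0 z)))\<^sup>2 < (cmod (g (w (0 + h) z)))\<^sup>2"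
      by blast
    from this(2)[of "d / 2"] this(1) have "(cmod z)\<^sup>2 < (cmod (g (w (d / 2) z)))\<^sup>2"
      using g(3)[OF z] by (simp add: w0)
    then show False
      using schwarz[of "d / 2"] \<open>d > 0\<close> by (simp add: power_mono leD)
  qed
  \<comment> \<open>After conjugation, inserting \<open>deriv F z * deriv g (F z) = 1\<close>
    produces the factor \<open>(cmod (deriv F z))\<^sup>2\<close> and leaves
    \<open>- (cnj z * u)\<close>.\<close>
  moreover have "Re (cis (- lam) * (z * deriv F z) * cnj (F z)) = - Re (cnj z * u) * (cmod (deriv F z))\<^sup>2"
  proof -
    have "cnj (cis (- lam) * (z * deriv F z) * cnj (F z))
        = cnj z * cis lam * F z * cnj (deriv F z) * (deriv F z * deriv g (F z))"
      by (simp add: g(2)[OF z] cis_cnj mult_ac)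
    also have "\<dots> = of_real ((cmod (deriv F z))\<^sup>2) * (- (cnj z * u))"
      unfolding complex_norm_square by (simp add: u_def mult_ac)
    finally have "Re (cnj (cis (- lam) * (z * deriv F z) * cnj (F z)))
        = Re (of_real ((cmod (deriv F z))\<^sup>2) * (- (cnj z * u)))"
      by (rule arg_cong)
    then show ?thesis by (simp only: complex_cnj Re_complex_of_real Im_complex_of_real times_complex.simps
        uminus_complex.simps cnj.simps) simp
  qed
  ultimately show ?thesis by (simp add: mult_nonpos_nonneg)
qed

text \<open>Logarithmic differentiation gives z F'/F = 1 + p z L'. As
  \<open>cis (- lam) * p = cos lam\<close>, the real part of \<open>cis (- lam)\<close> times this
  is \<open>cos lam * Re (1 + z * deriv L z)\<close>. Since Q = z exp(L), the quantity 1 + z L' is z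
  Q'/Q.\<close>

lemma power_transform_spirallike:
  assumes lam: "- pi / 2 < lam" "lam < pi / 2"
    and PT: "is_power_transform (cis lam * complex_of_real (cos lam)) Q F"
    and S: "spirallike lam F" and Q0: "Q 0 = 0"
  obtains L where "L holomorphic_on unit_disc" "\<And>z. z \<in> unit_disc \<Longrightarrow> Q z = z * exp (L z)"
    "Im (exp (L 0)) = 0" "\<And>z. z \<in> unit_disc \<Longrightarrow> 0 \<le> Re (1 + z * deriv L z)"
proof -
  define p where "p = cis lam * complex_of_real (cos lam)"
  have cos: "0 < cos lam" using lam cos_gt_zero_pi[of lam] by simp
  obtain L where L: "L analytic_on unit_disc" "\<And>z. z \<in> unit_disc - {0} \<Longrightarrow> exp (L z) = Q z / z"
      "\<And>z. z \<in> unit_disc \<Longrightarrow> F z = z * exp (p * L z)"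
    using PT by (auto simp: is_power_transform_def p_def)
  have hol: "L holomorphic_on unit_disc" using L(1) by (rule analytic_imp_holomorphic)
  have Lder: "(L has_field_derivative deriv L z) (at z)" if "z \<in> unit_disc" for z
    using hol that by (simp add: holomorphic_derivI[OF _ open_ball])
  have Fder: "(F has_field_derivative exp (p * L z) * (1 + p * (z * deriv L z))) (at z)"
    if z: "z \<in> unit_disc" for z
  proof -
    have "((\<lambda>z. z * exp (p * L z)) has_field_derivative exp (p * L z) * (1 + p * (z * deriv L z))) (at z)"
      by (auto intro!: derivative_eq_intros Lder z simp: algebra_simps)
    then show ?thesis
      by (rule has_field_derivative_transform_within_open[OF _ open_ball z]) (simp add: L(3))
  qed
  have FS: "F \<in> class_S" using S by (simp add: spirallike_def)
  show thesis
  proof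
    show "L holomorphic_on unit_disc" by fact
    show "Q z = z * exp (L z)" if "z \<in> unit_disc" for z
      using L(2)[of z] that Q0 by (cases "z = 0") auto
    have "exp (p * L 0) = 1"
      using DERIV_unique[OF Fder[of 0] class_S_normalized(4)[OF FS]] by simp
    \<comment> \<open>With \<open>p = cos lam * cis lam\<close>, the vanishing real part of
      \<open>p * L 0\<close> gives \<open>eq\<close>, and inserting it into the imaginary part
      yields \<open>Im (L 0) = Im (p * L 0)\<close>. So \<open>exp (L 0)\<close> is real, while its
      modulus stays open at this point.\<close>
    then obtain n :: int where n: "Re (p * L 0) = 0" "Im (p * L 0) = of_int (2 * n) * pi"
      by (auto simp: exp_eq_1)
    have eq: "cos lam * Re (L 0) = sin lam * Im (L 0)"
      using n(1) cos by (simp add: p_def algebra_simps)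
    have "Im (p * L 0) = cos lam * cos lam * Im (L 0) + sin lam * (cos lam * Re (L 0))"
      by (simp add: p_def algebra_simps)
    also have "\<dots> = ((cos lam)\<^sup>2 + (sin lam)\<^sup>2) * Im (L 0)"
      unfolding eq by (simp only: distrib_right power2_eq_square mult.assoc)
    finally have "Im (p * L 0) = ((cos lam)\<^sup>2 + (sin lam)\<^sup>2) * Im (L 0)" .
    then have "Im (L 0) = of_int n * (2 * pi)" using n(2) by simp
    then have "sin (Im (L 0)) = 0" by (simp add: sin_zero_iff_int2) (metis mult.commute mult.left_commute of_int_mult of_int_numeral)
    then show "Im (exp (L 0)) = 0" by (simp add: Im_exp)
    show "0 \<le> Re (1 + z * deriv L z)" if z: "z \<in> unit_disc" for z
    proof (cases "z = 0")
      case False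
      define K where "K = (cmod (z * exp (p * L z)))\<^sup>2"
      have "K > 0" using False by (simp add: K_def)
      have "cis (- lam) * (z * deriv F z) * cnj (F z)
          = (z * exp (p * L z) * cnj (z * exp (p * L z))) * (cis (- lam) * (1 + p * (z * deriv L z)))"
        unfolding DERIV_imp_deriv[OF Fder[OF z]] L(3)[OF z] by (simp only: mult_ac)
      also have "cis (- lam) * (1 + p * (z * deriv L z)) = cis (- lam) + cos lam * (z * deriv L z)"
        using cis_mult[of "- lam" lam] by (simp add: p_def ring_distribs flip: mult.assoc)
      finally have "Re (cis (- lam) * (z * deriv F z) * cnj (F z)) = K * (cos lam * Re (1 + z * deriv L z))"
        unfolding K_def complex_norm_square[symmetric] by (simp add: ring_distribs flip: of_real_power)
      then show ?thesis
        using spirallike_nonneg[OF S z] \<open>K > 0\<close> cos by (simp add: zero_le_mult_iff)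
    qed simp
  qed
qed

text \<open>On [0,1) the factor Q(x)/x = exp(L(x)) is real and nonnegative, so Q' = exp(L) (1 + x
  L') has nonnegative real part there. But Q'(x) is 1 minus the sum of n y_n x^(n-1), and x tends to
  1.\<close>

lemma negative_coefficients_sum_le:
  fixes y :: "nat \<Rightarrow> real"
  assumes y: "\<And>n. 0 \<le> y n" "y 1 = 0"
    and ser: "\<And>z. z \<in> unit_disc \<Longrightarrow> (\<lambda>n. of_real (y n) * z ^ n) sums (z - Q z)"
    and L: "L holomorphic_on unit_disc" "\<And>z. z \<in> unit_disc \<Longrightarrow> Q z = z * exp (L z)"
    and pos: "\<And>z. z \<in> unit_disc \<Longrightarrow> 0 \<le> Re (1 + z * deriv L z)"
  shows "summable (\<lambda>n. real n * y n)" "(\<Sum>n. real n * y n) \<le> 1"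
proof -
  have Lder: "(L has_field_derivative deriv L z) (at z)" if "z \<in> unit_disc" for z
    using L(1) that by (simp add: holomorphic_derivI[OF _ open_ball])
  have Qder: "(\<Sum>n. of_nat n * of_real (y n) * z ^ (n - 1)) = 1 - exp (L z) * (1 + z * deriv L z)"
    if z: "z \<in> unit_disc" for z
  proof (rule DERIV_unique)
    show "((\<lambda>z. z - Q z) has_field_derivative (\<Sum>n. of_nat n * of_real (y n) * z ^ (n - 1))) (at z)"
      using ser z by (rule disc_series_deriv)
    have "((\<lambda>z. z - z * exp (L z)) has_field_derivative 1 - exp (L z) * (1 + z * deriv L z)) (at z)"
      by (auto intro!: derivative_eq_intros Lder z simp: algebra_simps)
    then show "((\<lambda>z. z - Q z) has_field_derivative 1 - exp (L z) * (1 + z * deriv L z)) (at z)"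
      by (rule has_field_derivative_transform_within_open[OF _ open_ball z]) (simp add: L(2))
  qed
  have exp0: "exp (L 0) = 1"
  proof -
    have "((\<lambda>z. z - Q z) has_field_derivative of_real (y 1)) (at 0)"
      using disc_series_deriv_0(1)[OF ser] by simp
    then have "(\<Sum>n. of_nat n * of_real (y n) * 0 ^ (n - 1)) = complex_of_real (y 1)"
      by (intro DERIV_unique[OF disc_series_deriv(1)[OF ser]]) simp_all
    then show ?thesis using Qder[of 0] y by simp
  qed
  have Im0: "Im (exp (L (of_real x))) = 0" if x: "0 \<le> x" "x < 1" for x
  proof (cases "x = 0")
    case False
    have "(\<lambda>n. Im (of_real (y n) * of_real x ^ n)) sums Im (of_real x - Q (of_real x))"
      using x by (intro sums_Im ser) simp
    then have "Im (Q (of_real x)) = 0"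
      by (simp add: sums_iff flip: of_real_power of_real_mult)
    then show ?thesis using L(2)[of "of_real x"] x False by simp
  qed (simp add: exp0)
  \<comment> \<open>The real function exp(L) on the radius has value 1 at 0; by the intermediate
    value theorem a negative value would force a zero of \<open>exp\<close>.\<close>
  have Re0: "0 \<le> Re (exp (L (of_real x)))" if x: "0 \<le> x" "x < 1" for x
  proof (rule ccontr)
    assume neg: "\<not> 0 \<le> Re (exp (L (of_real x)))"
    have "continuous_on {0..x} (\<lambda>t. L (complex_of_real t))"
      by (rule continuous_on_compose2[OF holomorphic_on_imp_continuous_on[OF L(1)]])
         (use x in \<open>auto intro!: continuous_intros\<close>)
    then have "continuous_on {0..x} (\<lambda>t. Re (exp (L (complex_of_real t))))"
      by (intro continuous_intros)
    then obtain t where t: "0 \<le> t" "t \<le> x" "Re (exp (L (complex_of_real t))) = 0"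
      using IVT2'[of "\<lambda>t. Re (exp (L (complex_of_real t)))" x 0 0] neg exp0 x by auto
    then have "exp (L (complex_of_real t)) = 0"
      using Im0[of t] x by (intro complex_eqI) auto
    then show False by simp
  qed
  have le1: "(\<Sum>n<N. real n * y n * x ^ (n - 1)) \<le> 1" if x: "0 \<le> x" "x < 1" for x N
  proof -
    have eq: "complex_of_nat n * of_real (y n) * of_real x ^ (n - 1)
        = of_real (real n * y n * x ^ (n - 1))" for n by simp
    have s: "summable (\<lambda>n. complex_of_nat n * of_real (y n) * of_real x ^ (n - 1))"
      using x by (intro disc_series_deriv(2)[OF ser]) auto
    have rs: "summable (\<lambda>n. real n * y n * x ^ (n - 1))"
      using s unfolding eq by (simp only: summable_of_real_iff)
    have "(\<Sum>n<N. real n * y n * x ^ (n - 1)) \<le> (\<Sum>n. real n * y n * x ^ (n - 1))"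
      using rs y x by (intro sum_le_suminf) auto
    also have "\<dots> = Re (\<Sum>n. complex_of_nat n * of_real (y n) * of_real x ^ (n - 1))"
      unfolding eq suminf_of_real[OF rs, symmetric] by simp
    \<comment> \<open>The real part of the product splits into a product of real parts because
      \<open>exp (L x)\<close> is real on the radius.\<close>
    also have "\<dots> = 1 - Re (exp (L (of_real x))) * Re (1 + of_real x * deriv L (of_real x))"
      using x Im0[OF x] Qder[of "of_real x"] by simp
    also have "\<dots> \<le> 1"
      using Re0[OF x] pos[of "of_real x"] x by simp
    finally show ?thesis .
  qed
  \<comment> \<open>Passing to the limit in finite sums needs only continuity of polynomials;
    nonnegativity of \<open>y\<close> then gives convergence of the full series.\<close>
  have partial: "(\<Sum>n<N. real n * y n) \<le> 1" for N
  proof (rule tendsto_upperbound[of "\<lambda>x. \<Sum>n<N. real n * y n * x ^ (n - 1)" _ "at_left (1::real)"])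
    show "((\<lambda>x. \<Sum>n<N. real n * y n * x ^ (n - 1)) \<longlongrightarrow> (\<Sum>n<N. real n * y n)) (at_left 1)"
      by (auto intro!: tendsto_eq_intros)
    show "\<forall>\<^sub>F x in at_left 1. (\<Sum>n<N. real n * y n * x ^ (n - 1)) \<le> 1"
      using eventually_at_left_real[OF zero_less_one] by eventually_elim (simp only: greaterThanLessThan_iff le1 less_imp_le)
  qed simp
  then show *: "summable (\<lambda>n. real n * y n)"
    using y by (intro summableI_nonneg_bounded[of _ 1]) auto
  show "(\<Sum>n. real n * y n) \<le> 1"
    by (rule suminf_le_const[OF * partial])
qed

section \<open>Passage from \<open>H\<close> and \<open>G\<close> to the harmonic mapping\<close>

theorem theorem2p7:
  fixes lam B :: real and A :: "nat \<Rightarrow> real"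
    and d a b :: "nat \<Rightarrow> complex" and H G :: "complex \<Rightarrow> complex"
  assumes lam: "- pi / 2 < lam" "lam < pi / 2"
    and A: "\<And>n. n \<ge> 1 \<Longrightarrow>
      A n = cmod (1 + of_nat n * cis (- lam)) + cmod (1 - of_nat n * cis (- lam))"
    and B: "B = cmod (1 + cis (- lam)) - cmod (1 - cis (- lam))"
    and d: "\<And>n. n \<ge> 1 \<Longrightarrow> cmod (d n) \<le> real n * B / A n"
    and H: "H analytic_on unit_disc"
      "disc_series 2 (\<lambda>n. complex_of_real (cmod (a n))) (\<lambda>z. z - H z)"
    and G: "G analytic_on unit_disc"
      "disc_series 1 (\<lambda>n. complex_of_real (cmod (b n))) G"
    and F: "\<And>\<epsilon>. cmod \<epsilon> = 1 \<Longrightarrow>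
      \<exists>F. is_power_transform (cis lam * complex_of_real (cos lam)) (\<lambda>z. H z + \<epsilon> * G z) F \<and>
          spirallike lam F"
  shows "(\<forall>z\<in>unit_disc. summable (\<lambda>n. d (n + 2) * a (n + 2) * z ^ (n + 2))) \<and>
    (\<forall>z\<in>unit_disc. summable (\<lambda>n. d (n + 1) * b (n + 1) * z ^ (n + 1))) \<and>
    hereditarily_spirallike lam
      (\<lambda>z. (z + (\<Sum>n. d (n + 2) * a (n + 2) * z ^ (n + 2)))
           + cnj (\<Sum>n. d (n + 1) * b (n + 1) * z ^ (n + 1)))"
proof -
  define C where "C = spiral_weight lam"
  have AC: "A n = C n" if "n \<ge> 1" for n using A[OF that] by (simp add: C_def spiral_weight_def)
  have BC: "B = spiral_bound lam" using B by (simp add: spiral_bound_def)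
  have Bpos: "0 < B" unfolding BC by (rule spiral_bound_pos[OF lam])
  define a' where "a' n = (if n < 2 then 0 else cmod (a n))" for n
  define b' where "b' n = (if n < 1 then 0 else cmod (b n))" for n
  have a'_eq: "(if n < 2 then 0 else complex_of_real (cmod (a n))) = of_real (a' n)"
    and b'_eq: "(if n < 1 then 0 else complex_of_real (cmod (b n))) = of_real (b' n)" for n
    by (simp_all add: a'_def b'_def)
  have serH: "(\<lambda>n. of_real (a' n) * z ^ n) sums (z - H z)"
    and serG: "(\<lambda>n. of_real (b' n) * z ^ n) sums G z" if "z \<in> unit_disc" for z
    using H(2) G(2) that unfolding disc_series_padded a'_eq b'_eq by auto
  note dH = disc_series_deriv_0[OF serH] and dG = disc_series_deriv_0[OF serG]
  have H0: "H 0 = 0" and G0: "G 0 = 0" using dH(2) dG(2) by (simp_all add: a'_def b'_def)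
  \<comment> \<open>Taking \<open>\<epsilon> = \<i>\<close>, the derivative of
    \<open>H + \<i> * G\<close> at 0 is \<open>1 + \<i> * cmod (b 1)\<close>. It equals
    \<open>exp (L 0)\<close>, which is real.\<close>
  have b1: "b 1 = 0"
  proof -
    obtain F where "is_power_transform (cis lam * complex_of_real (cos lam)) (\<lambda>z. H z + \<i> * G z) F"
        "spirallike lam F"
      using F[of \<i>] by auto
    moreover have "H 0 + \<i> * G 0 = 0" by (simp add: H0 G0)
    ultimately obtain L where L: "L holomorphic_on unit_disc"
        "\<And>z. z \<in> unit_disc \<Longrightarrow> H z + \<i> * G z = z * exp (L z)" "Im (exp (L 0)) = 0"
      using power_transform_spirallike[OF lam] by blast
    have Lder: "(L has_field_derivative deriv L 0) (at 0)"
      using L(1) by (simp add: holomorphic_derivI[OF _ open_ball])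
    have "((\<lambda>z. z - (z - H z) + \<i> * G z) has_field_derivative 1 - of_real (a' 1) + \<i> * of_real (b' 1)) (at 0)"
      by (rule DERIV_add[OF DERIV_diff[OF DERIV_ident dH(1)] DERIV_cmult[OF dG(1)]])
    then have 1: "((\<lambda>z. H z + \<i> * G z) has_field_derivative 1 + \<i> * of_real (b' 1)) (at 0)"
      by (simp add: a'_def)
    have "((\<lambda>z. z * exp (L z)) has_field_derivative exp (L 0)) (at 0)"
      by (auto intro!: derivative_eq_intros Lder)
    then have "((\<lambda>z. H z + \<i> * G z) has_field_derivative exp (L 0)) (at 0)"
      by (rule has_field_derivative_transform_within_open[OF _ open_ball[of 0 1]]) (simp_all add: L(2))
    from DERIV_unique[OF this 1] show ?thesis using L(3) by (simp add: b'_def)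
  qed
  \<comment> \<open>The choice \<open>\<epsilon> = - 1\<close> gives z - (H - G) the coefficients
    \<open>a' n + b' n\<close>, all nonnegative, with the one of index 1 equal to 0 by
    \<open>b1\<close>.\<close>
  define y where "y n = a' n + b' n" for n
  have ysum: "summable (\<lambda>n. real n * y n)" "(\<Sum>n. real n * y n) \<le> 1"
  proof -
    obtain F where "is_power_transform (cis lam * complex_of_real (cos lam)) (\<lambda>z. H z + (- 1) * G z) F"
        "spirallike lam F"
      using F[of "- 1"] by auto
    moreover have "H 0 + (- 1) * G 0 = 0" by (simp add: H0 G0)
    ultimately obtain L where L: "L holomorphic_on unit_disc"
        "\<And>z. z \<in> unit_disc \<Longrightarrow> H z + (- 1) * G z = z * exp (L z)"
        "\<And>z. z \<in> unit_disc \<Longrightarrow> 0 \<le> Re (1 + z * deriv L z)"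
      using power_transform_spirallike[OF lam] by blast
    have y: "0 \<le> y n" "y 1 = 0" for n using b1 by (auto simp: y_def a'_def b'_def)
    have ser: "(\<lambda>n. of_real (y n) * z ^ n) sums (z - (H z + (- 1) * G z))" if "z \<in> unit_disc" for z
      using sums_add[OF serH[OF that] serG[OF that]] by (simp add: y_def algebra_simps)
    show "summable (\<lambda>n. real n * y n)" "(\<Sum>n. real n * y n) \<le> 1"
      using negative_coefficients_sum_le[OF y ser L] by auto
  qed
  define c where "c n = (if n < 2 then 0 else d n * a n)" for n
  \<comment> \<open>Cutting off below 2 instead of 1 does not change the co-analytic part, because
    \<open>b 1 = 0\<close>.\<close>
  define e where "e n = (if n < 2 then 0 else d n * b n)" for n
  \<comment> \<open>The bound on \<open>d n\<close> is exactly what trades the weight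
    \<open>C n\<close> for \<open>n\<close> times B.\<close>
  have bound: "C n * (cmod (c n) + cmod (e n)) \<le> B * (real n * y n)" for n
  proof (cases "n < 2")
    case True
    then show ?thesis using Bpos by (simp add: c_def e_def y_def a'_def b'_def)
  next
    case False
    have "0 < C n" using spiral_weight_ge[of n lam] False by (simp add: C_def)
    then have "C n * cmod (d n) \<le> real n * B"
      using d[of n] AC[of n] False by (simp add: field_simps)
    then have "C n * cmod (d n) * y n \<le> real n * B * y n"
      by (intro mult_right_mono) (auto simp: y_def a'_def b'_def)
    then show ?thesis
      using False by (simp add: c_def e_def y_def a'_def b'_def norm_mult algebra_simps)
  qed
  have summ: "summable (\<lambda>n. spiral_weight lam n * (cmod (c n) + cmod (e n)))"
    by (rule summable_comparison_test'[OF summable_mult[OF ysum(1), of B], of 0])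
       (use bound spiral_weight_nonneg in \<open>auto simp: C_def abs_mult\<close>)
  have "(\<Sum>n. spiral_weight lam n * (cmod (c n) + cmod (e n))) \<le> (\<Sum>n. B * (real n * y n))"
    using bound by (intro suminf_le summ summable_mult ysum) (simp add: C_def)
  also have "\<dots> \<le> B * 1"
    unfolding suminf_mult[OF ysum(1)] using Bpos ysum(2) by (intro mult_left_mono) auto
  finally have le: "(\<Sum>n. spiral_weight lam n * (cmod (c n) + cmod (e n))) \<le> spiral_bound lam"
    by (simp add: BC)
  have zero: "c n = 0 \<and> e n = 0" if "n < 2" for n using that by (simp add: c_def e_def)
  note coeffs = powser_summable[OF lam zero summ le] hereditarily_spirallike_coefficients[OF lam zero summ le]
  have shift: "(\<lambda>n. d (n + 2) * a (n + 2) * z ^ (n + 2)) = (\<lambda>n. c (n + 2) * z ^ (n + 2))"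
    "(\<lambda>n. d (n + 1) * b (n + 1) * z ^ (n + 1)) = (\<lambda>n. e (n + 1) * z ^ (n + 1))" for z
    using b1 by (auto simp: fun_eq_iff c_def e_def less_Suc_eq)
  \<comment> \<open>Equality of the \<open>sums\<close> predicates transfers summability and the
    value of the sum at once from the shifted series to the full one.\<close>
  have "(sums) (\<lambda>n. c (n + 2) * z ^ (n + 2)) = (sums) (\<lambda>n. c n * z ^ n)"
    "(sums) (\<lambda>n. e (n + 1) * z ^ (n + 1)) = (sums) (\<lambda>n. e n * z ^ n)" for z
    by (rule ext, rule sums_zero_iff_shift, simp add: zero)+
  then have series:
    "summable (\<lambda>n. d (n + 2) * a (n + 2) * z ^ (n + 2)) \<longleftrightarrow> summable (\<lambda>n. c n * z ^ n)"
    "summable (\<lambda>n. d (n + 1) * b (n + 1) * z ^ (n + 1)) \<longleftrightarrow> summable (\<lambda>n. e n * z ^ n)"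
    "(\<Sum>n. d (n + 2) * a (n + 2) * z ^ (n + 2)) = (\<Sum>n. c n * z ^ n)"
    "(\<Sum>n. d (n + 1) * b (n + 1) * z ^ (n + 1)) = (\<Sum>n. e n * z ^ n)" for z
    unfolding shift summable_def suminf_def by (simp_all only:)
  show ?thesis
    unfolding series using coeffs by auto
qed

end
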